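(* Let $(X,\mu,\ast)$ be a fuzzy metric space and let $A,B,S,T:X\to X$ be self-mappings satisfying: $$A(X)\subset T(X)\quad\text{and}\quad B(X)\subset S(X),$$ and, for all $x,y\in X$ and all $t>0$, $$F\Big(\mu\big(Ax,By,\tfrac t2\big),\ \mu\big(Sx,Ty,\tfrac t2\big),\ \mu\big(Ax,Sx,\tfrac t2\big),\ \mu\big(By,Ty,\tfrac t2\big),\ \mu\big(Sx,By,\tfrac t2\big),\ \mu\big(Ax,Ty,\tfrac t2\big)\Big)\le 1,$$ where $F:[0,1]^6\to\mathbb{R}$ is a continuous function satisfying properties $(F_1)$, $(F_2)$, $(F_3)$ and $(F_4)$. Suppose that $(A,S)$ or $(B,T)$ satisfies property (E.A.), and that the pairs $(A,S)$ and $(B,T)$ are weakly compatible. If the range of one of $A,B,S,T$ is a closed subset of $X$, then the common fixed point problem of $\{A,B,S,T\}$ is well-posed.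
   Context: Continuous t-norm: a binary operation $\ast:[0,1]\times[0,1]\to[0,1]$ that is commutative, associative, continuous, satisfies $a\ast 1=a$ for all $a\in[0,1]$, and satisfies $a\ast b\le c\ast d$ whenever $a\le c$, $b\le d$ ($a,b,c,d\in[0,1]$). Fuzzy metric space: a triple $(X,\mu,\ast)$ where $X$ is a set, $\ast$ is a continuous t-norm and $\mu:X^2\times(0,\infty)\to[0,1]$ satisfies, for all $x,y,z\in X$ and $s,t>0$: (i) $\mu(x,y,t)>0$; (ii) $\mu(x,y,t)=1$ if and only if $x=y$; (iii) $\mu(x,y,t)=\mu(y,x,t)$; (iv) $\mu(x,y,s)\ast\mu(y,z,t)\le\mu(x,z,s+t)$; (v) $\mu(x,y,\cdot):(0,\infty)\to(0,1]$ is continuous. Convergence: $x_n\to x$ means $\lim_{n\to\infty}\mu(x_n,x,t)=1$ for every $t>0$. A subset $P\subseteq X$ is closed if whenever a sequence in $P$ converges to $x\in X$, then $x\in P$. Weak compatibility: self-maps $A$ and $B$ of $X$ are weakly compatible if they commute at their coincidence points: $Az=Bz$ implies $ABz=BAz$. Property (E.A.): a pair $(A,B)$ of self-maps of $X$ satisfies property (E.A.) if there is a sequence $(x_n)$ in $X$ such that $\lim_{n\to\infty}Ax_n=\lim_{n\to\infty}Bx_n=z$ for some $z\in X$. Properties of $F$ (a continuous function on $[0,1]^6$): $(F_1)$ $F(u(t),1,1,u(t),u(t),1)>1$ for all $t>0$ with $0\le u(t)<1$; $(F_2)$ $F(u(t),1,u(t),1,1,u(t))>1$ for all $t>0$ with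 $0\le u(t)<1$; $(F_3)$ $F(u(t),u(t),1,1,u(t),u(t))>1$ for all $t>0$ with $0\le u(t)<1$ (that is, for every real number $u\in[0,1)$ in place of $u(t)$); $(F_4)$ there exists $k\in(0,1)$ such that, for all functions $u,v,w:(0,\infty)\to[0,1)$, if $F(u(t),v(t),1,w(t),u(t),v(t))\le 1$ for all $t>0$, then $u(t)\ge\frac1k\,w(t)$ for all $t>0$. Well-posedness: for a set $\mathcal{P}$ of self-mappings of $X$, the common fixed point problem of $\mathcal{P}$ is well-posed if (1) $\mathcal{P}$ has a unique common fixed point $x$ in $X$ (that is, $x$ is the unique point of $X$ with $Gx=x$ for all $G\in\mathcal{P}$); and (2) for every sequence $(x_n)$ in $X$ such that $\lim_{n\to\infty}\mu(x_n,Gx_n,t)=1$ for all $G\in\mathcal{P}$ and all $t>0$, one has $\lim_{n\to\infty}\mu(x_n,x,t)=1$ for all $t>0$. *)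

theory Defs
  imports "HOL-Analysis.Analysis"
begin

text \<open>
  Operations and maps are total functions of the logic; only their values on the carriers
  (the interval from 0 to 1, the set \<open>X\<close>, positive times) are constrained.
\<close>

locale continuous_t_norm =
  fixes tn :: "real \<Rightarrow> real \<Rightarrow> real"  (infixl \<open>\<star>\<close> 70)
  assumes tn_closed: "\<lbrakk>a \<in> {0..1}; b \<in> {0..1}\<rbrakk> \<Longrightarrow> a \<star> b \<in> {0..1}"
    and tn_commute: "\<lbrakk>a \<in> {0..1}; b \<in> {0..1}\<rbrakk> \<Longrightarrow> a \<star> b = b \<star> a"
    and tn_assoc: "\<lbrakk>a \<in> {0..1}; b \<in> {0..1}; c \<in> {0..1}\<rbrakk> \<Longrightarrow> (a \<star> b) \<star> c = a \<star> (b \<star> c)"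
    and tn_continuous: "continuous_on ({0..1} \<times> {0..1}) (\<lambda>(a, b). a \<star> b)"
    and tn_one: "a \<in> {0..1} \<Longrightarrow> a \<star> 1 = a"
    and tn_mono: "\<lbrakk>a \<in> {0..1}; b \<in> {0..1}; c \<in> {0..1}; d \<in> {0..1}; a \<le> c; b \<le> d\<rbrakk>
                   \<Longrightarrow> a \<star> b \<le> c \<star> d"

locale fuzzy_metric_space = continuous_t_norm tn
  for X :: "'a set" and \<mu> :: "'a \<Rightarrow> 'a \<Rightarrow> real \<Rightarrow> real"
    and tn :: "real \<Rightarrow> real \<Rightarrow> real"  (infixl \<open>\<star>\<close> 70) +
  assumes mu_range: "\<lbrakk>x \<in> X; y \<in> X; t > 0\<rbrakk> \<Longrightarrow> \<mu> x y t \<in> {0..1}"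
    and mu_pos: "\<lbrakk>x \<in> X; y \<in> X; t > 0\<rbrakk> \<Longrightarrow> \<mu> x y t > 0"
    and mu_eq_1_iff: "\<lbrakk>x \<in> X; y \<in> X; t > 0\<rbrakk> \<Longrightarrow> \<mu> x y t = 1 \<longleftrightarrow> x = y"
    and mu_sym: "\<lbrakk>x \<in> X; y \<in> X; t > 0\<rbrakk> \<Longrightarrow> \<mu> x y t = \<mu> y x t"
    and mu_triangle: "\<lbrakk>x \<in> X; y \<in> X; z \<in> X; s > 0; t > 0\<rbrakk>
                       \<Longrightarrow> \<mu> x y s \<star> \<mu> y z t \<le> \<mu> x z (s + t)"
    and mu_continuous: "\<lbrakk>x \<in> X; y \<in> X\<rbrakk> \<Longrightarrow> continuous_on {0<..} (\<mu> x y)"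

definition fuzzy_converges :: "('a \<Rightarrow> 'a \<Rightarrow> real \<Rightarrow> real) \<Rightarrow> (nat \<Rightarrow> 'a) \<Rightarrow> 'a \<Rightarrow> bool" where
  "fuzzy_converges \<mu> x l \<longleftrightarrow> (\<forall>t>0. (\<lambda>n. \<mu> (x n) l t) \<longlonglongrightarrow> 1)"

definition fuzzy_closed :: "'a set \<Rightarrow> ('a \<Rightarrow> 'a \<Rightarrow> real \<Rightarrow> real) \<Rightarrow> 'a set \<Rightarrow> bool" where
  "fuzzy_closed X \<mu> P \<longleftrightarrow> P \<subseteq> X \<and>
     (\<forall>x l. (\<forall>n. x n \<in> P) \<longrightarrow> l \<in> X \<longrightarrow> fuzzy_converges \<mu> x l \<longrightarrow> l \<in> P)"

definition weakly_compatible :: "'a set \<Rightarrow> ('a \<Rightarrow> 'a) \<Rightarrow> ('a \<Rightarrow> 'a) \<Rightarrow> bool" where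
  "weakly_compatible X A B \<longleftrightarrow> (\<forall>z\<in>X. A z = B z \<longrightarrow> A (B z) = B (A z))"

definition property_EA ::
  "'a set \<Rightarrow> ('a \<Rightarrow> 'a \<Rightarrow> real \<Rightarrow> real) \<Rightarrow> ('a \<Rightarrow> 'a) \<Rightarrow> ('a \<Rightarrow> 'a) \<Rightarrow> bool" where
  "property_EA X \<mu> A B \<longleftrightarrow>
     (\<exists>x. (\<forall>n. x n \<in> X) \<and>
       (\<exists>z\<in>X. fuzzy_converges \<mu> (\<lambda>n. A (x n)) z \<and> fuzzy_converges \<mu> (\<lambda>n. B (x n)) z))"

type_synonym real6 = "real \<times> real \<times> real \<times> real \<times> real \<times> real"

definition unit_cube6 :: "real6 set" where
  "unit_cube6 = {0..1} \<times> {0..1} \<times> {0..1} \<times> {0..1} \<times> {0..1} \<times> {0..1}"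

definition prop_F1 :: "(real6 \<Rightarrow> real) \<Rightarrow> bool" where
  "prop_F1 F \<longleftrightarrow> (\<forall>u. 0 \<le> u \<and> u < 1 \<longrightarrow> F (u, 1, 1, u, u, 1) > 1)"

definition prop_F2 :: "(real6 \<Rightarrow> real) \<Rightarrow> bool" where
  "prop_F2 F \<longleftrightarrow> (\<forall>u. 0 \<le> u \<and> u < 1 \<longrightarrow> F (u, 1, u, 1, 1, u) > 1)"

definition prop_F3 :: "(real6 \<Rightarrow> real) \<Rightarrow> bool" where
  "prop_F3 F \<longleftrightarrow> (\<forall>u. 0 \<le> u \<and> u < 1 \<longrightarrow> F (u, u, 1, 1, u, u) > 1)"

definition prop_F4 :: "(real6 \<Rightarrow> real) \<Rightarrow> bool" where
  "prop_F4 F \<longleftrightarrow>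
     (\<exists>k. 0 < k \<and> k < 1 \<and>
       (\<forall>u v w :: real \<Rightarrow> real.
          (\<forall>t>0. u t \<in> {0..<1} \<and> v t \<in> {0..<1} \<and> w t \<in> {0..<1}) \<longrightarrow>
          (\<forall>t>0. F (u t, v t, 1, w t, u t, v t) \<le> 1) \<longrightarrow>
          (\<forall>t>0. u t \<ge> (1 / k) * w t)))"

definition common_fixed_point :: "('a \<Rightarrow> 'a) set \<Rightarrow> 'a \<Rightarrow> bool" where
  "common_fixed_point \<P> x \<longleftrightarrow> (\<forall>G\<in>\<P>. G x = x)"

definition well_posed_cfp ::
  "'a set \<Rightarrow> ('a \<Rightarrow> 'a \<Rightarrow> real \<Rightarrow> real) \<Rightarrow> ('a \<Rightarrow> 'a) set \<Rightarrow> bool" where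
  "well_posed_cfp X \<mu> \<P> \<longleftrightarrow>
     (\<exists>x\<in>X. common_fixed_point \<P> x \<and>
       (\<forall>y\<in>X. common_fixed_point \<P> y \<longrightarrow> y = x) \<and>
       (\<forall>xs. (\<forall>n. xs n \<in> X) \<longrightarrow>
          (\<forall>G\<in>\<P>. \<forall>t>0. (\<lambda>n. \<mu> (xs n) (G (xs n)) t) \<longlonglongrightarrow> 1) \<longrightarrow>
          fuzzy_converges \<mu> xs x))"

end

theory Submission
  imports Defs "HOL-Probability.Helly_Selection"
begin

text \<open>
  Everything is deduced from one principle about sequences in place of points. Write
  \<open>p \<asymp> q\<close> when \<open>\<mu> (p n) (q n) t\<close> tends to 1 for every \<open>t > 0\<close>; this is an equivalence relation on
  sequences, constant sequences are related only if they are equal, and a sequence is related to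
  a constant exactly if it converges to it. All parts of the theorem are then claims that
  certain sequences are related:
  \<^item> if \<open>S x \<asymp> B y \<asymp> T y\<close>, then \<open>A x\<close> joins them (\<open>A_follows\<close>, from \<open>F\<^sub>2\<close>), and dually for \<open>B\<close>
    (\<open>B_follows\<close>, from \<open>F\<^sub>1\<close>);
  \<^item> if \<open>A x \<asymp> S x\<close> and \<open>B y \<asymp> T y\<close>, then \<open>A x \<asymp> B y\<close> (\<open>images_asymptotic\<close>, from \<open>F\<^sub>3\<close>).

  To prove such a claim, one passes to the limit in the contraction inequality. If, say,
  \<open>\<mu> (A (x n)) (B (y n)) t\<close> tends to some \<open>c < 1\<close>, the other entries ought to tend to 1 or to the
  same \<open>c\<close>, because their arguments are asymptotic to those of the first entry; the
  limit of the inequality then contradicts the relevant property of \<open>F\<close>. The difficulty is the word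
  "ought": replacing \<open>p\<close> by \<open>q \<asymp> p\<close> in the triangle inequality costs a little time, and the
  functions \<open>\<mu> (p n) (r n)\<close> need not be equicontinuous in time, so at a given \<open>t\<close> the limits
  can differ. They are, however, increasing in \<open>t\<close>, so by Helly's selection theorem a subsequence
  converges at all continuity points of some monotone limit function, and at such points a small
  loss of time does not matter. Continuity points are dense, hence one can be found
  where the limit is still below 1. This is \<open>asymptotic_dichotomy\<close>.

  The fixed point itself comes from property (E.A.): the range inclusions and the first claim
  provide sequences along which all four maps converge to one point \<open>z\<close>. A closed range puts
  \<open>z\<close> into the range of \<open>S\<close> or of \<open>T\<close>, and the first claim with constant sequences gives coincidence
  points of both pairs with common value \<open>z\<close>. Weak compatibility makes \<open>z\<close> a coincidence point as
  well, and the second claim yields that \<open>z\<close> is fixed, that it is the only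
  common fixed point, and that every sequence of approximate fixed points converges to it.
\<close>

section \<open>Real sequences and monotone functions\<close>

lemma nonconvergent_unit_subseq:
  fixes f :: "nat \<Rightarrow> real"
  assumes unit: "\<And>n. f n \<in> {0..1}" and nlim: "\<not> f \<longlonglongrightarrow> l"
  obtains s b where "strict_mono s" "(f \<circ> s) \<longlonglongrightarrow> b" "b \<in> {0..1}" "b \<noteq> l"
proof -
  obtain e where "e > 0" and inf: "\<And>N. \<exists>n\<ge>N. dist (f n) l \<ge> e"
    using nlim unfolding lim_sequentially by (meson not_less)
  have "infinite {n. dist (f n) l \<ge> e}"
    unfolding infinite_nat_iff_unbounded_le using inf by auto
  then obtain r :: "nat \<Rightarrow> nat" where r: "strict_mono r" "\<And>n. dist (f (r n)) l \<ge> e"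
    using infinite_enumerate by (metis (mono_tags, lifting) mem_Collect_eq)
  have "\<forall>n. (f \<circ> r) n \<in> {0..1}" using unit by auto
  then obtain b k where bk: "b \<in> {0..1}" "strict_mono (k :: nat \<Rightarrow> nat)" "(f \<circ> r \<circ> k) \<longlonglongrightarrow> b"
    using compact_imp_seq_compact[OF compact_Icc] by (metis seq_compactE)
  have "e \<le> dist b l"
    by (rule LIMSEQ_le_const[OF tendsto_dist[OF bk(3) tendsto_const]]) (use r in auto)
  then have "b \<noteq> l" using \<open>e > 0\<close> by auto
  with that[of "r \<circ> k" b] bk r show thesis
    by (auto simp: strict_mono_o o_assoc)
qed

lemma mono_isCont_dense:
  fixes G :: "real \<Rightarrow> real"
  assumes "mono G" "a < b"
  obtains x where "a < x" "x < b" "isCont G x"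
proof -
  have "\<not> {a<..<b} \<subseteq> {x. \<not> isCont G x}"
    using mono_ctble_discont[OF \<open>mono G\<close>] uncountable_open_interval[of a b] \<open>a < b\<close>
    by (meson countable_subset)
  with that show thesis by auto
qed

text \<open>
  The bounds are asked for only at continuity points of \<open>G\<close>, since these are the only points
  where Helly's theorem identifies the limit.
\<close>
lemma mono_isCont_squeeze:
  fixes G :: "real \<Rightarrow> real"
  assumes "mono G" "isCont G x"
    and lower: "\<And>y. \<lbrakk>y < x; isCont G y\<rbrakk> \<Longrightarrow> G y \<le> b"
    and upper: "\<And>y. \<lbrakk>x < y; isCont G y\<rbrakk> \<Longrightarrow> b \<le> G y"
  shows "b = G x"
proof (rule ccontr)
  assume "b \<noteq> G x"
  then have "\<bar>G x - b\<bar> > 0" by simp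
  with \<open>isCont G x\<close> obtain d where d: "d > 0" "\<And>y. \<bar>y - x\<bar> < d \<Longrightarrow> \<bar>G y - G x\<bar> < \<bar>G x - b\<bar>"
    unfolding continuous_at_eps_delta dist_real_def by metis
  obtain y where y: "x - d < y" "y < x" "isCont G y"
    using mono_isCont_dense[OF \<open>mono G\<close>, of "x - d" x] d(1) by auto
  obtain z where z: "x < z" "z < x + d" "isCont G z"
    using mono_isCont_dense[OF \<open>mono G\<close>, of x "x + d"] d(1) by auto
  have "\<bar>G y - G x\<bar> < \<bar>G x - b\<bar>" "\<bar>G z - G x\<bar> < \<bar>G x - b\<bar>"
    using y z by (auto intro!: d(2))
  moreover have "G y \<le> b" "b \<le> G z" "G y \<le> G x" "G x \<le> G z"
    using lower upper y z by (auto intro: monoD[OF \<open>mono G\<close>])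
  ultimately show False by linarith
qed

section \<open>Asymptotic sequences in a fuzzy metric space\<close>

context fuzzy_metric_space
begin

text \<open>
  Membership in \<open>X\<close> is part of the relation, so that it need not be carried along as a side
  condition: \<open>\<mu>\<close> is unconstrained off \<open>X\<close>.
\<close>
definition asymptotic :: "(nat \<Rightarrow> 'a) \<Rightarrow> (nat \<Rightarrow> 'a) \<Rightarrow> bool"  (infix \<open>\<asymp>\<close> 50) where
  "p \<asymp> q \<longleftrightarrow> (\<forall>n. p n \<in> X \<and> q n \<in> X) \<and> (\<forall>t>0. (\<lambda>n. \<mu> (p n) (q n) t) \<longlonglongrightarrow> 1)"

lemma mu_self: "x \<in> X \<Longrightarrow> t > 0 \<Longrightarrow> \<mu> x x t = 1"
  using mu_eq_1_iff by simp

lemma mu_mono: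
  assumes "x \<in> X" "y \<in> X" "0 < s" "s \<le> t"
  shows "\<mu> x y s \<le> \<mu> x y t"
proof (cases "s = t")
  case False
  then have "\<mu> x y s \<star> \<mu> y y (t - s) \<le> \<mu> x y (s + (t - s))"
    using assms by (intro mu_triangle) auto
  moreover have "\<mu> y y (t - s) = 1" using mu_self assms False by auto
  ultimately show ?thesis using tn_one mu_range assms by auto
qed simp

lemma tn_tendsto:
  assumes "f \<longlonglongrightarrow> a" "g \<longlonglongrightarrow> b" "\<And>n. f n \<in> {0..1}" "\<And>n. g n \<in> {0..1}"
  shows "(\<lambda>n. f n \<star> g n) \<longlonglongrightarrow> a \<star> b"
proof -
  have "a \<in> {0..1}" "b \<in> {0..1}"
    using closed_sequentially[OF closed_atLeastAtMost] assms by blast+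
  then have "(\<lambda>n. (\<lambda>(a, b). a \<star> b) (f n, g n)) \<longlonglongrightarrow> (\<lambda>(a, b). a \<star> b) (a, b)"
    using assms
    by (intro continuous_on_tendsto_compose[OF tn_continuous] tendsto_Pair) (auto intro: always_eventually)
  then show ?thesis by simp
qed

lemma asymptotic_in_space: "p \<asymp> q \<Longrightarrow> p n \<in> X" "p \<asymp> q \<Longrightarrow> q n \<in> X"
  by (auto simp: asymptotic_def)

lemma asymptotic_tendsto: "p \<asymp> q \<Longrightarrow> t > 0 \<Longrightarrow> (\<lambda>n. \<mu> (p n) (q n) t) \<longlonglongrightarrow> 1"
  by (auto simp: asymptotic_def)

lemma asymptotic_refl: "(\<And>n. p n \<in> X) \<Longrightarrow> p \<asymp> p"
  by (auto simp: asymptotic_def mu_self)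

lemma asymptotic_sym: "p \<asymp> q \<Longrightarrow> q \<asymp> p"
  using mu_sym by (auto simp: asymptotic_def)

lemma asymptotic_subseq: "p \<asymp> q \<Longrightarrow> strict_mono s \<Longrightarrow> (\<lambda>n. p (s n)) \<asymp> (\<lambda>n. q (s n))"
  unfolding asymptotic_def
  using LIMSEQ_subseq_LIMSEQ[unfolded o_def] by blast

lemma asymptotic_trans:
  assumes "p \<asymp> q" "q \<asymp> r"
  shows "p \<asymp> r"
  unfolding asymptotic_def
proof (intro conjI allI impI)
  note in_X = asymptotic_in_space[OF assms(1)] asymptotic_in_space[OF assms(2)]
  fix t :: real assume "t > 0"
  have "(\<lambda>n. \<mu> (p n) (q n) (t/2) \<star> \<mu> (q n) (r n) (t/2)) \<longlonglongrightarrow> 1 \<star> 1"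
    using assms \<open>t > 0\<close> in_X mu_range by (intro tn_tendsto asymptotic_tendsto) auto
  then have lim: "(\<lambda>n. \<mu> (p n) (q n) (t/2) \<star> \<mu> (q n) (r n) (t/2)) \<longlonglongrightarrow> 1"
    using tn_one by simp
  have "\<mu> (p n) (q n) (t/2) \<star> \<mu> (q n) (r n) (t/2) \<le> \<mu> (p n) (r n) t" for n
    using mu_triangle[of "p n" "q n" "r n" "t/2" "t/2"] in_X \<open>t > 0\<close> by auto
  then show "(\<lambda>n. \<mu> (p n) (r n) t) \<longlonglongrightarrow> 1"
    using mu_range[OF in_X(1) in_X(4) \<open>t > 0\<close>]
    by (intro tendsto_sandwich[OF _ _ lim tendsto_const]) (auto intro!: always_eventually)
qed (use assms asymptotic_in_space in auto)

lemma asymptotic_const_eq: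
  assumes "(\<lambda>_. x) \<asymp> (\<lambda>_. y)"
  shows "x = y"
  using asymptotic_tendsto[OF assms, of 1] asymptotic_in_space[OF assms] mu_eq_1_iff[of x y 1]
  by (auto simp: LIMSEQ_const_iff)

lemma fuzzy_converges_iff_asymptotic:
  assumes "\<And>n. p n \<in> X" "l \<in> X"
  shows "fuzzy_converges \<mu> p l \<longleftrightarrow> p \<asymp> (\<lambda>_. l)"
  using assms by (auto simp: fuzzy_converges_def asymptotic_def)

text \<open>
  Moving from \<open>(p, r)\<close> to \<open>(q, r')\<close> uses the triangle inequality twice, and each use costs an
  arbitrarily small amount \<open>d\<close> of time. Hence the two limits are comparable only when the second
  is taken at a strictly later time.
\<close>
lemma asymptotic_limit_le:
  assumes "p \<asymp> q" "r \<asymp> r'" "0 < s" "s < t"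
    and lims: "(\<lambda>n. \<mu> (p n) (r n) s) \<longlonglongrightarrow> a" "(\<lambda>n. \<mu> (q n) (r' n) t) \<longlonglongrightarrow> b"
  shows "a \<le> b"
proof -
  define d where "d = (t - s) / 2"
  have d: "d > 0" "s + d + d = t" using \<open>s < t\<close> by (auto simp: d_def field_simps)
  note in_X = asymptotic_in_space[OF assms(1)] asymptotic_in_space[OF assms(2)]
  have a: "a \<in> {0..1}"
    by (rule closed_sequentially[OF closed_atLeastAtMost _ lims(1)])
      (intro mu_range in_X \<open>0 < s\<close>)
  have one_d: "(\<lambda>n. \<mu> (p n) (q n) d) \<longlonglongrightarrow> 1" "(\<lambda>n. \<mu> (r n) (r' n) d) \<longlonglongrightarrow> 1"
    using assms d asymptotic_tendsto by auto
  have mid: "\<mu> (p n) (r n) s \<star> \<mu> (r n) (r' n) d \<in> {0..1}" for n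
    using in_X \<open>0 < s\<close> d by (intro tn_closed mu_range) auto
  have "(\<lambda>n. (\<mu> (p n) (r n) s \<star> \<mu> (r n) (r' n) d) \<star> \<mu> (p n) (q n) d) \<longlonglongrightarrow> (a \<star> 1) \<star> 1"
    using in_X \<open>0 < s\<close> d mid mu_range lims(1) one_d by (intro tn_tendsto) auto
  then have lim: "(\<lambda>n. (\<mu> (p n) (r n) s \<star> \<mu> (r n) (r' n) d) \<star> \<mu> (p n) (q n) d) \<longlonglongrightarrow> a"
    using tn_one a by auto
  have "(\<mu> (p n) (r n) s \<star> \<mu> (r n) (r' n) d) \<star> \<mu> (p n) (q n) d \<le> \<mu> (q n) (r' n) t" for n
  proof -
    have "(\<mu> (p n) (r n) s \<star> \<mu> (r n) (r' n) d) \<star> \<mu> (p n) (q n) d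
        \<le> \<mu> (p n) (r' n) (s + d) \<star> \<mu> (p n) (q n) d"
      using in_X \<open>0 < s\<close> d mid mu_range mu_triangle by (intro tn_mono) auto
    also have "\<dots> = \<mu> (q n) (p n) d \<star> \<mu> (p n) (r' n) (s + d)"
      using tn_commute mu_range mu_sym in_X \<open>0 < s\<close> d by auto
    also have "\<dots> \<le> \<mu> (q n) (r' n) t"
      using mu_triangle[of "q n" "p n" "r' n" d "s + d"] in_X \<open>0 < s\<close> d by (auto simp: algebra_simps)
    finally show ?thesis .
  qed
  then show ?thesis by (intro LIMSEQ_le[OF lim lims(2)]) auto
qed

text \<open>
  If \<open>p\<close> and \<open>r\<close> are not asymptotic, this is witnessed at some time \<open>t\<close> in a way that is
  insensitive to replacing either sequence by an asymptotic one. The time \<open>t\<close> has to be a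
  continuity point of the limit of the monotone functions \<open>\<mu> (p n) (r n)\<close> along a subsequence;
  there the limits at slightly earlier and slightly later times squeeze that of any
  \<open>\<mu> (q n) (r' n) t\<close>.
\<close>
lemma asymptotic_dichotomy:
  assumes "\<And>n. p n \<in> X" "\<And>n. r n \<in> X"
  obtains "p \<asymp> r"
  | s t c where "strict_mono s" "0 < t" "0 \<le> c" "c < 1"
      "\<And>q r'. \<lbrakk>p \<asymp> q; r \<asymp> r'\<rbrakk> \<Longrightarrow> (\<lambda>n. \<mu> (q (s n)) (r' (s n)) t) \<longlonglongrightarrow> c"
proof (cases "p \<asymp> r")
  case False
  then obtain t0 where t0: "t0 > 0" "\<not> (\<lambda>n. \<mu> (p n) (r n) t0) \<longlonglongrightarrow> 1"
    using assms by (auto simp: asymptotic_def)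
  obtain k c0 where k: "strict_mono k" "((\<lambda>n. \<mu> (p n) (r n) t0) \<circ> k) \<longlonglongrightarrow> c0" "c0 \<in> {0..1}" "c0 \<noteq> 1"
    using nonconvergent_unit_subseq[of "\<lambda>n. \<mu> (p n) (r n) t0", OF _ t0(2)] mu_range assms t0(1)
    by metis
  \<comment> \<open>Helly's theorem concerns functions on the whole line; \<open>exp\<close> turns positive times into reals.\<close>
  define f where "f n x = \<mu> (p (k n)) (r (k n)) (exp x)" for n x
  have f_cont: "continuous (at_right x) (f n)" for n x
  proof -
    have "continuous_on UNIV (\<lambda>x. \<mu> (p (k n)) (r (k n)) (exp x))"
      using assms by (intro continuous_on_compose2[OF mu_continuous] continuous_intros) auto
    then have "isCont (f n) x"
      unfolding f_def by (simp add: continuous_on_eq_continuous_at)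
    then show ?thesis by (rule continuous_at_imp_continuous_at_within)
  qed
  have f_mono: "mono (f n)" for n
    unfolding f_def using assms mu_mono by (intro monoI) auto
  have f_unit: "f n x \<in> {0..1}" for n x
    unfolding f_def using assms mu_range by auto
  have f_bound: "\<bar>f n x\<bar> \<le> 1" for n x
    using f_unit[of n x] by auto
  obtain h G where h: "strict_mono h" and G: "mono G"
    "\<And>x. isCont G x \<Longrightarrow> (\<lambda>n. f (h n) x) \<longlonglongrightarrow> G x"
    using Helly_selection[of f, OF f_cont f_mono f_bound] by blast
  define s where "s = k \<circ> h"
  have s: "strict_mono s" unfolding s_def using k h by (simp add: strict_mono_o)
  have G_lim: "(\<lambda>n. \<mu> (p (s n)) (r (s n)) (exp x)) \<longlonglongrightarrow> G x" if "isCont G x" for x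
    using G(2)[OF that] by (simp add: f_def s_def)
  \<comment> \<open>A continuity point before time \<open>t0\<close>: by monotonicity the limit there is at most \<open>c0 < 1\<close>.\<close>
  obtain x where x: "x < ln t0" "isCont G x"
    using mono_isCont_dense[OF G(1), of "ln t0 - 1" "ln t0"] by auto
  have "G x \<ge> 0"
    using f_unit by (intro LIMSEQ_le_const[OF G(2)[OF x(2)]]) auto
  have "exp x \<le> t0" using x(1) t0(1) by (metis exp_le_cancel_iff exp_ln less_imp_le)
  then have below: "f (h n) x \<le> \<mu> (p (s n)) (r (s n)) t0" for n
    unfolding f_def s_def using assms by (auto intro!: mu_mono)
  have "(\<lambda>n. \<mu> (p (s n)) (r (s n)) t0) \<longlonglongrightarrow> c0"
    using LIMSEQ_subseq_LIMSEQ[OF k(2) h] by (simp add: o_def s_def)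
  then have "G x \<le> c0"
    using below by (intro LIMSEQ_le[OF G(2)[OF x(2)]]) auto
  then have "G x < 1" using k by auto
  have stable: "(\<lambda>n. \<mu> (q (s n)) (r' (s n)) (exp x)) \<longlonglongrightarrow> G x"
    if q: "p \<asymp> q" and r': "r \<asymp> r'" for q r'
  proof (rule ccontr)
    assume nlim: "\<not> (\<lambda>n. \<mu> (q (s n)) (r' (s n)) (exp x)) \<longlonglongrightarrow> G x"
    obtain j b where j: "strict_mono j"
      "((\<lambda>n. \<mu> (q (s n)) (r' (s n)) (exp x)) \<circ> j) \<longlonglongrightarrow> b" "b \<noteq> G x"
      by (rule nonconvergent_unit_subseq[OF _ nlim])
        (use mu_range asymptotic_in_space(2)[OF q] asymptotic_in_space(2)[OF r'] in simp_all)
    have sj: "strict_mono (\<lambda>n. s (j n))"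
      using s j(1) by (simp add: strict_mono_def)
    have pq: "(\<lambda>n. p (s (j n))) \<asymp> (\<lambda>n. q (s (j n)))"
      and rr': "(\<lambda>n. r (s (j n))) \<asymp> (\<lambda>n. r' (s (j n)))"
      using asymptotic_subseq[OF _ sj] q r' by auto
    have b_lim: "(\<lambda>n. \<mu> (q (s (j n))) (r' (s (j n))) (exp x)) \<longlonglongrightarrow> b"
      using j(2) by (simp add: o_def)
    have G_lim': "(\<lambda>n. \<mu> (p (s (j n))) (r (s (j n))) (exp y)) \<longlonglongrightarrow> G y" if "isCont G y" for y
      using LIMSEQ_subseq_LIMSEQ[OF G_lim[OF that] j(1)] by (simp add: o_def)
    have "b = G x"
    proof (rule mono_isCont_squeeze[OF G(1) x(2)])
      fix y assume "y < x" "isCont G y"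
      then show "G y \<le> b"
        using asymptotic_limit_le[OF pq rr' _ _ G_lim' b_lim] by auto
    next
      fix y assume "x < y" "isCont G y"
      then show "b \<le> G y"
        using asymptotic_limit_le[OF asymptotic_sym[OF pq] asymptotic_sym[OF rr'] _ _ b_lim G_lim']
        by auto
    qed
    with j show False by simp
  qed
  show ?thesis
    using that(2)[OF s _ \<open>G x \<ge> 0\<close> \<open>G x < 1\<close> stable] by simp
qed

end

section \<open>Four maps under an implicit contraction\<close>

locale implicit_contraction = fuzzy_metric_space X \<mu> tn
  for X :: "'a set" and \<mu> :: "'a \<Rightarrow> 'a \<Rightarrow> real \<Rightarrow> real"
    and tn :: "real \<Rightarrow> real \<Rightarrow> real"  (infixl \<open>\<star>\<close> 70) +
  fixes A B S T :: "'a \<Rightarrow> 'a" and F :: "real6 \<Rightarrow> real"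
  assumes maps: "A ` X \<subseteq> X" "B ` X \<subseteq> X" "S ` X \<subseteq> X" "T ` X \<subseteq> X"
    and ranges: "A ` X \<subseteq> T ` X" "B ` X \<subseteq> S ` X"
    and F_continuous: "continuous_on unit_cube6 F"
    and F1: "prop_F1 F" and F2: "prop_F2 F" and F3: "prop_F3 F"
    and contraction: "\<lbrakk>x \<in> X; y \<in> X; t > 0\<rbrakk> \<Longrightarrow>
      F (\<mu> (A x) (B y) t, \<mu> (S x) (T y) t, \<mu> (A x) (S x) t,
         \<mu> (B y) (T y) t, \<mu> (S x) (B y) t, \<mu> (A x) (T y) t) \<le> 1"
begin

lemma map_in_space [simp]:
  assumes "x \<in> X"
  shows "A x \<in> X" "B x \<in> X" "S x \<in> X" "T x \<in> X"
  using assms maps by auto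

text \<open>
  The hypotheses are symmetric under exchange of \<open>(A, S)\<close> and \<open>(B, T)\<close>, provided that the third
  and fourth and the fifth and sixth arguments of \<open>F\<close> change places too; this exchanges
  \<open>F\<^sub>1\<close> and \<open>F\<^sub>2\<close>.
\<close>
lemma swapped:
  "implicit_contraction X \<mu> tn B A T S (\<lambda>(a, b, c, d, e, f). F (a, b, d, c, f, e))"
proof
  show "continuous_on unit_cube6 (\<lambda>(a, b, c, d, e, f). F (a, b, d, c, f, e))"
    unfolding case_prod_unfold
    by (intro continuous_on_compose2[OF F_continuous] continuous_intros) (auto simp: unit_cube6_def)
  show "(\<lambda>(a, b, c, d, e, f). F (a, b, d, c, f, e))
          (\<mu> (B x) (A y) t, \<mu> (T x) (S y) t, \<mu> (B x) (T x) t,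
           \<mu> (A y) (S y) t, \<mu> (T x) (A y) t, \<mu> (B x) (S y) t) \<le> 1"
    if "x \<in> X" "y \<in> X" "t > 0" for x y t
    using contraction[of y x t] that mu_sym[of _ _ t] map_in_space by simp
qed (use maps ranges F1 F2 F3 in \<open>auto simp: prop_F1_def prop_F2_def prop_F3_def\<close>)

lemma contraction_limit:
  assumes xy: "\<And>n. x n \<in> X" "\<And>n. y n \<in> X" and "t > 0"
    and "(\<lambda>n. \<mu> (A (x n)) (B (y n)) t) \<longlonglongrightarrow> a" "(\<lambda>n. \<mu> (S (x n)) (T (y n)) t) \<longlonglongrightarrow> b"
      "(\<lambda>n. \<mu> (A (x n)) (S (x n)) t) \<longlonglongrightarrow> c" "(\<lambda>n. \<mu> (B (y n)) (T (y n)) t) \<longlonglongrightarrow> d"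
      "(\<lambda>n. \<mu> (S (x n)) (B (y n)) t) \<longlonglongrightarrow> e" "(\<lambda>n. \<mu> (A (x n)) (T (y n)) t) \<longlonglongrightarrow> f"
  shows "F (a, b, c, d, e, f) \<le> 1"
proof -
  let ?P = "\<lambda>n. (\<mu> (A (x n)) (B (y n)) t, \<mu> (S (x n)) (T (y n)) t, \<mu> (A (x n)) (S (x n)) t,
         \<mu> (B (y n)) (T (y n)) t, \<mu> (S (x n)) (B (y n)) t, \<mu> (A (x n)) (T (y n)) t)"
  have lim: "?P \<longlonglongrightarrow> (a, b, c, d, e, f)"
    using assms by (intro tendsto_Pair)
  have unit: "?P n \<in> unit_cube6" for n
    unfolding unit_cube6_def using xy \<open>t > 0\<close> by (intro SigmaI mu_range) simp_all
  have "closed unit_cube6"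
    unfolding unit_cube6_def by (intro closed_Times closed_atLeastAtMost)
  then have "(a, b, c, d, e, f) \<in> unit_cube6"
    by (rule closed_sequentially[OF _ unit lim])
  then have "(\<lambda>n. F (?P n)) \<longlonglongrightarrow> F (a, b, c, d, e, f)"
    using unit by (intro continuous_on_tendsto_compose[OF F_continuous lim]) auto
  then show ?thesis
    by (rule LIMSEQ_le_const2) (use contraction xy \<open>t > 0\<close> in auto)
qed

text \<open>
  If \<open>A x\<close> were not asymptotic to \<open>B y\<close>, then by \<open>asymptotic_dichotomy\<close> its nearness to each of
  \<open>B y\<close>, \<open>S x\<close> and \<open>T y\<close>, which are asymptotic to one another, would have one and the same limit
  \<open>c < 1\<close>. The contraction becomes \<open>F (c, 1, c, 1, 1, c) \<le> 1\<close>, against \<open>F\<^sub>2\<close>.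
\<close>
lemma A_follows:
  assumes x: "\<And>n. x n \<in> X" and y: "\<And>n. y n \<in> X"
    and SB: "(\<lambda>n. S (x n)) \<asymp> (\<lambda>n. B (y n))" and TB: "(\<lambda>n. T (y n)) \<asymp> (\<lambda>n. B (y n))"
  shows "(\<lambda>n. A (x n)) \<asymp> (\<lambda>n. B (y n))"
proof -
  have in_X: "A (x n) \<in> X" "B (y n) \<in> X" for n using x y by auto
  show ?thesis
  proof (rule asymptotic_dichotomy[of "\<lambda>n. A (x n)" "\<lambda>n. B (y n)", OF in_X])
    fix s t c assume s: "strict_mono s" "0 < t" "0 \<le> c" "c < 1" and
      lim: "\<And>q r'. \<lbrakk>(\<lambda>n. A (x n)) \<asymp> q; (\<lambda>n. B (y n)) \<asymp> r'\<rbrakk>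
        \<Longrightarrow> (\<lambda>n. \<mu> (q (s n)) (r' (s n)) t) \<longlonglongrightarrow> c"
    have A: "(\<lambda>n. A (x n)) \<asymp> (\<lambda>n. A (x n))" and B: "(\<lambda>n. B (y n)) \<asymp> (\<lambda>n. B (y n))"
      using in_X asymptotic_refl by auto
    note BS = asymptotic_sym[OF SB] and BT = asymptotic_sym[OF TB]
    note ones = asymptotic_tendsto[OF asymptotic_subseq[OF _ s(1)] s(2)]
    have "F (c, 1, c, 1, 1, c) \<le> 1"
      by (rule contraction_limit[OF _ _ s(2) lim[OF A B] ones[OF asymptotic_trans[OF SB BT]]
            lim[OF A BS] ones[OF BT] ones[OF SB] lim[OF A BT]]) (use x y in auto)
    then show ?thesis using F2 s unfolding prop_F2_def by force
  qed
qed

lemma B_follows: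
  assumes "\<And>n. x n \<in> X" "\<And>n. y n \<in> X"
    and "(\<lambda>n. T (y n)) \<asymp> (\<lambda>n. A (x n))" "(\<lambda>n. S (x n)) \<asymp> (\<lambda>n. A (x n))"
  shows "(\<lambda>n. B (y n)) \<asymp> (\<lambda>n. A (x n))"
  using implicit_contraction.A_follows[OF swapped, of y x] assms by blast

text \<open>
  Here every mixed entry of the contraction compares a sequence asymptotic to \<open>A x\<close> with one
  asymptotic to \<open>B y\<close>, so the limit inequality would be \<open>F (c, c, 1, 1, c, c) \<le> 1\<close> with
  \<open>c < 1\<close>, against \<open>F\<^sub>3\<close>.
\<close>
lemma images_asymptotic:
  assumes x: "\<And>n. x n \<in> X" and y: "\<And>n. y n \<in> X"
    and AS: "(\<lambda>n. A (x n)) \<asymp> (\<lambda>n. S (x n))" and BT: "(\<lambda>n. B (y n)) \<asymp> (\<lambda>n. T (y n))"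
  shows "(\<lambda>n. A (x n)) \<asymp> (\<lambda>n. B (y n))"
proof -
  have in_X: "A (x n) \<in> X" "B (y n) \<in> X" for n using x y by auto
  show ?thesis
  proof (rule asymptotic_dichotomy[of "\<lambda>n. A (x n)" "\<lambda>n. B (y n)", OF in_X])
    fix s t c assume s: "strict_mono s" "0 < t" "0 \<le> c" "c < 1" and
      lim: "\<And>q r'. \<lbrakk>(\<lambda>n. A (x n)) \<asymp> q; (\<lambda>n. B (y n)) \<asymp> r'\<rbrakk>
        \<Longrightarrow> (\<lambda>n. \<mu> (q (s n)) (r' (s n)) t) \<longlonglongrightarrow> c"
    have A: "(\<lambda>n. A (x n)) \<asymp> (\<lambda>n. A (x n))" and B: "(\<lambda>n. B (y n)) \<asymp> (\<lambda>n. B (y n))"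
      using in_X asymptotic_refl by auto
    note ones = asymptotic_tendsto[OF asymptotic_subseq[OF _ s(1)] s(2)]
    have "F (c, c, 1, 1, c, c) \<le> 1"
      by (rule contraction_limit[OF _ _ s(2) lim[OF A B] lim[OF AS BT] ones[OF AS] ones[OF BT]
            lim[OF AS B] lim[OF A BT]]) (use x y in auto)
    then show ?thesis using F3 s unfolding prop_F3_def by force
  qed
qed

lemma images_eq:
  assumes "x \<in> X" "y \<in> X" "A x = S x" "B y = T y"
  shows "A x = B y"
proof (rule asymptotic_const_eq)
  show "(\<lambda>_. A x) \<asymp> (\<lambda>_. B y)"
    by (rule images_asymptotic[of "\<lambda>_. x" "\<lambda>_. y"]) (use assms in \<open>auto intro: asymptotic_refl\<close>)
qed

definition common_limit :: "(nat \<Rightarrow> 'a) \<Rightarrow> (nat \<Rightarrow> 'a) \<Rightarrow> 'a \<Rightarrow> bool" where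
  "common_limit x y z \<longleftrightarrow> (\<forall>n. x n \<in> X \<and> y n \<in> X) \<and>
     (\<lambda>n. A (x n)) \<asymp> (\<lambda>_. z) \<and> (\<lambda>n. S (x n)) \<asymp> (\<lambda>_. z) \<and>
     (\<lambda>n. B (y n)) \<asymp> (\<lambda>_. z) \<and> (\<lambda>n. T (y n)) \<asymp> (\<lambda>_. z)"

text \<open>
  Property (E.A.) concerns only one pair. Since \<open>A (x n)\<close> lies in the range of \<open>T\<close>, the other pair
  gets a sequence \<open>y\<close> with \<open>T (y n) = A (x n)\<close>, and \<open>B_follows\<close> makes \<open>B y\<close> converge as well.
\<close>
lemma common_limit_of_EA:
  assumes "property_EA X \<mu> A S"
  shows "\<exists>x y z. common_limit x y z"
proof -
  obtain x z where x: "\<And>n. x n \<in> X" and z: "z \<in> X"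
    and "fuzzy_converges \<mu> (\<lambda>n. A (x n)) z" "fuzzy_converges \<mu> (\<lambda>n. S (x n)) z"
    using assms unfolding property_EA_def by blast
  then have Az: "(\<lambda>n. A (x n)) \<asymp> (\<lambda>_. z)" and Sz: "(\<lambda>n. S (x n)) \<asymp> (\<lambda>_. z)"
    using fuzzy_converges_iff_asymptotic by auto
  have "\<forall>n. \<exists>y\<in>X. T y = A (x n)" using ranges(1) x by (metis imageE image_subset_iff)
  then obtain y where y: "\<And>n. y n \<in> X" "\<And>n. T (y n) = A (x n)" by metis
  have "(\<lambda>n. B (y n)) \<asymp> (\<lambda>n. A (x n))"
    using x y asymptotic_trans[OF Sz asymptotic_sym[OF Az]]
    by (intro B_follows) (auto intro: asymptotic_refl)
  from asymptotic_trans[OF this Az] have "common_limit x y z"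
    unfolding common_limit_def using x y Az Sz by simp
  then show ?thesis by blast
qed

lemma common_limit_swapped:
  "implicit_contraction.common_limit X \<mu> B A T S y x z \<longleftrightarrow> common_limit x y z"
  unfolding common_limit_def implicit_contraction.common_limit_def[OF swapped] by auto

text \<open>
  Both coincidences are instances of the asymptotic claims with constant sequences: \<open>A u\<close>
  follows the convergent sequences \<open>B y\<close> and \<open>T y\<close>, and then \<open>z = A u\<close> has a preimage \<open>v\<close>
  under \<open>T\<close>, at which \<open>B v\<close> follows \<open>A u\<close>.
\<close>
lemma coincidence_of_S_value:
  assumes lim: "common_limit x y z" and u: "u \<in> X" "S u = z"
  shows "A u = z" "\<exists>v\<in>X. B v = z \<and> T v = z"
proof -
  have y: "\<And>n. y n \<in> X" and Bz: "(\<lambda>n. B (y n)) \<asymp> (\<lambda>_. z)" and Tz: "(\<lambda>n. T (y n)) \<asymp> (\<lambda>_. z)"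
    using lim by (auto simp: common_limit_def)
  have "(\<lambda>_. A u) \<asymp> (\<lambda>n. B (y n))"
    by (rule A_follows)
      (use u y asymptotic_sym[OF Bz] asymptotic_trans[OF Tz asymptotic_sym[OF Bz]] in simp_all)
  from asymptotic_trans[OF this Bz] show Au: "A u = z" by (rule asymptotic_const_eq)
  obtain v where v: "v \<in> X" "T v = z" using ranges(1) u Au by auto
  have "(\<lambda>_. B v) \<asymp> (\<lambda>_. A u)"
    by (rule B_follows) (use u v Au in \<open>auto intro: asymptotic_refl\<close>)
  then have "B v = A u" by (rule asymptotic_const_eq)
  with v Au show "\<exists>v\<in>X. B v = z \<and> T v = z" by auto
qed

lemma limit_in_closed_range:
  assumes "fuzzy_closed X \<mu> (f ` X)" "\<And>n. x n \<in> X" "(\<lambda>n. f (x n)) \<asymp> (\<lambda>_. z)"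
  shows "z \<in> f ` X"
proof -
  have "fuzzy_converges \<mu> (\<lambda>n. f (x n)) z" "z \<in> X"
    using assms(3) by (simp_all add: fuzzy_converges_def asymptotic_def)
  moreover have "\<forall>n. f (x n) \<in> f ` X" using assms(2) by simp
  ultimately show ?thesis
    using assms(1) unfolding fuzzy_closed_def by (elim conjE allE[of _ "\<lambda>n. f (x n)"]) simp
qed

text \<open>
  Whichever range is closed, the inclusions \<open>A ` X \<subseteq> T ` X\<close> and \<open>B ` X \<subseteq> S ` X\<close> leave just two
  cases for \<open>z\<close>, which the exchange of the pairs interchanges.
\<close>
lemma coincidence:
  assumes "property_EA X \<mu> A S \<or> property_EA X \<mu> B T"
    and closed: "fuzzy_closed X \<mu> (A ` X) \<or> fuzzy_closed X \<mu> (B ` X) \<or>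
         fuzzy_closed X \<mu> (S ` X) \<or> fuzzy_closed X \<mu> (T ` X)"
  obtains u v z where "u \<in> X" "v \<in> X" "A u = z" "S u = z" "B v = z" "T v = z"
proof -
  interpret sw: implicit_contraction X \<mu> tn B A T S "\<lambda>(a, b, c, d, e, f). F (a, b, d, c, f, e)"
    by (rule swapped)
  obtain x y z where lim: "common_limit x y z"
    using assms(1) common_limit_of_EA sw.common_limit_of_EA common_limit_swapped by blast
  have "z \<in> A ` X \<or> z \<in> B ` X \<or> z \<in> S ` X \<or> z \<in> T ` X"
    using closed lim limit_in_closed_range[of A x] limit_in_closed_range[of B y]
      limit_in_closed_range[of S x] limit_in_closed_range[of T y]
    unfolding common_limit_def by blast
  then have "z \<in> S ` X \<or> z \<in> T ` X" using ranges by blast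
  then consider u where "u \<in> X" "S u = z" | v where "v \<in> X" "T v = z" by auto
  then show thesis
  proof cases
    case 1
    with coincidence_of_S_value[OF lim] that show thesis by blast
  next
    case 2
    with sw.coincidence_of_S_value[OF lim[folded common_limit_swapped]] that show thesis by blast
  qed
qed

text \<open>
  By weak compatibility \<open>A z = A (S u) = S (A u) = S z\<close> and likewise \<open>B z = T z\<close>, so
  \<open>images_eq\<close> applies to \<open>z\<close> and \<open>v\<close>, to \<open>u\<close> and \<open>z\<close>, and to a second fixed point and \<open>z\<close>. Stability is
  \<open>images_asymptotic\<close> for an approximate fixed point sequence and the constant sequence \<open>z\<close>.
\<close>
lemma well_posed_of_coincidence:
  assumes "u \<in> X" "v \<in> X" "A u = z" "S u = z" "B v = z" "T v = z"
    and "weakly_compatible X A S" "weakly_compatible X B T"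
  shows "well_posed_cfp X \<mu> {A, B, S, T}"
proof -
  have z: "z \<in> X" using assms by auto
  have AS: "A z = S z" and BT: "B z = T z"
    using assms unfolding weakly_compatible_def by auto
  have "A z = z" using images_eq[of z v] z assms AS by auto
  moreover have "B z = z" using images_eq[of u z] z assms BT by auto
  ultimately have fix_z: "A z = z" "B z = z" "S z = z" "T z = z" using AS BT by auto
  show ?thesis
    unfolding well_posed_cfp_def
  proof (intro bexI[OF _ z] conjI ballI allI impI)
    show "common_fixed_point {A, B, S, T} z"
      using fix_z by (auto simp: common_fixed_point_def)
    show "y = z" if "y \<in> X" "common_fixed_point {A, B, S, T} y" for y
      using that images_eq[of y z] z fix_z by (auto simp: common_fixed_point_def)
    fix xs assume xs: "\<forall>n. xs n \<in> X"
      and approx: "\<forall>G\<in>{A, B, S, T}. \<forall>t>0. (\<lambda>n. \<mu> (xs n) (G (xs n)) t) \<longlonglongrightarrow> 1"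
    have xA: "xs \<asymp> (\<lambda>n. A (xs n))" and xS: "xs \<asymp> (\<lambda>n. S (xs n))"
      using xs approx by (auto simp: asymptotic_def)
    have "(\<lambda>n. A (xs n)) \<asymp> (\<lambda>_. B z)"
      using xs z fix_z asymptotic_trans[OF asymptotic_sym[OF xA] xS]
      by (intro images_asymptotic) (auto intro: asymptotic_refl)
    then have "xs \<asymp> (\<lambda>_. z)"
      using asymptotic_trans[OF xA] fix_z by auto
    then show "fuzzy_converges \<mu> xs z"
      using fuzzy_converges_iff_asymptotic xs z by auto
  qed
qed

end

theorem theorem5p3:
  fixes X :: "'a set" and \<mu> :: "'a \<Rightarrow> 'a \<Rightarrow> real \<Rightarrow> real" and tn :: "real \<Rightarrow> real \<Rightarrow> real"
    and A B S T :: "'a \<Rightarrow> 'a" and F :: "real6 \<Rightarrow> real"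
  assumes "fuzzy_metric_space X \<mu> tn"
    and "A ` X \<subseteq> X" and "B ` X \<subseteq> X" and "S ` X \<subseteq> X" and "T ` X \<subseteq> X"
    and "A ` X \<subseteq> T ` X" and "B ` X \<subseteq> S ` X"
    and "continuous_on unit_cube6 F"
    and "prop_F1 F" and "prop_F2 F" and "prop_F3 F" and "prop_F4 F"
    and "\<And>x y t. \<lbrakk>x \<in> X; y \<in> X; t > 0\<rbrakk> \<Longrightarrow>
           F (\<mu> (A x) (B y) (t/2), \<mu> (S x) (T y) (t/2), \<mu> (A x) (S x) (t/2),
              \<mu> (B y) (T y) (t/2), \<mu> (S x) (B y) (t/2), \<mu> (A x) (T y) (t/2)) \<le> 1"
    and "property_EA X \<mu> A S \<or> property_EA X \<mu> B T"
    and "weakly_compatible X A S" and "weakly_compatible X B T"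
    and "fuzzy_closed X \<mu> (A ` X) \<or> fuzzy_closed X \<mu> (B ` X) \<or>
         fuzzy_closed X \<mu> (S ` X) \<or> fuzzy_closed X \<mu> (T ` X)"
  shows "well_posed_cfp X \<mu> {A, B, S, T}"
proof -
  have contraction: "F (\<mu> (A x) (B y) t, \<mu> (S x) (T y) t, \<mu> (A x) (S x) t,
      \<mu> (B y) (T y) t, \<mu> (S x) (B y) t, \<mu> (A x) (T y) t) \<le> 1"
    if "x \<in> X" "y \<in> X" "t > 0" for x y t
    \<comment> \<open>As \<open>t\<close> is arbitrary, the halved times of the hypothesis are all positive times.\<close>
    using assms(13)[of x y "2 * t"] that by simp
  interpret implicit_contraction X \<mu> tn A B S T F
    using assms contraction
    by (intro implicit_contraction.intro implicit_contraction_axioms.intro) simp_all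
  obtain u v z where "u \<in> X" "v \<in> X" "A u = z" "S u = z" "B v = z" "T v = z"
    using coincidence assms(14,17) by blast
  then show ?thesis
    using well_posed_of_coincidence assms(15,16) by blast
qed

end
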